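(* There exists a Pólya frequency function $M : \mathbb{R} \to [0,\infty)$ such that (1) $M$ is even, continuous and vanishes nowhere; (2) $M$ is increasing on $(-\infty,0]$ and decreasing on $[0,\infty)$; and (3) $M^n : x \mapsto M(x)^n$ is not a Pólya frequency function for any integer $n \geq 2$.
   Context: A Pólya frequency function is a function $\Lambda : \mathbb{R} \to [0,\infty)$ that is Lebesgue integrable, non-zero at two or more points, and such that $\det(\Lambda(x_i-y_j))_{i,j=1}^n \geq 0$ for all $n \in \mathbb{N}$ and all real $x_1 < \cdots < x_n$ and $y_1 < \cdots < y_n$. "Increasing" and "decreasing" are meant strictly. *)

theory Defs
  imports "HOL-Analysis.Analysis" "Jordan_Normal_Form.Determinant"
begin

text \<open>
  The order \<open>n\<close> of the minors is quantified inside the definition, so the matrices are those of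
  \<open>Jordan_Normal_Form\<close>; \<open>det\<close> and \<open>mat\<close> are qualified because \<open>HOL-Analysis\<close> has its own. The nodes
  \<open>x\<^sub>1 < \<dots> < x\<^sub>n\<close> are given as \<open>x 0 < \<dots> < x (n - 1)\<close>; the values of \<open>x\<close> and \<open>y\<close> at arguments
  \<open>\<ge> n\<close> play no role.
\<close>

definition polya_frequency_function :: "(real \<Rightarrow> real) \<Rightarrow> bool" where
  "polya_frequency_function \<Lambda> \<longleftrightarrow>
     (\<forall>t. 0 \<le> \<Lambda> t) \<and>
     integrable lebesgue \<Lambda> \<and>
     (\<exists>s t. s \<noteq> t \<and> \<Lambda> s \<noteq> 0 \<and> \<Lambda> t \<noteq> 0) \<and>
     (\<forall>n\<ge>1. \<forall>x y :: nat \<Rightarrow> real. strict_mono_on {..<n} x \<longrightarrow> strict_mono_on {..<n} y \<longrightarrow>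
        0 \<le> Determinant.det (Matrix.mat n n (\<lambda>(i, j). \<Lambda> (x i - y j))))"

end

theory Submission
  imports Defs
begin

text \<open>
  Write \<open>q = exp (- \<bar>x\<bar>)\<close> and take \<open>M = 7 q - 5 q\<^sup>3 + 2 q\<^sup>4\<close>, which up to a constant is the
  function with bilateral Laplace transform \<open>1 / ((1 - s\<^sup>2) (9 - s\<^sup>2) (16 - s\<^sup>2))\<close>. It arises from
  the one-sided exponential kernel by successive convolutions with one-sided exponentials, that is, by
  solving equations \<open>h' + a h = f\<close>, and this preserves total nonnegativity.

  For \<open>n \<ge> 2\<close> one has \<open>M\<^sup>n = q\<^sup>n (g\<^sub>0 + g\<^sub>2 q\<^sup>2 + g\<^sub>3 q\<^sup>3 + g\<^sub>4 q\<^sup>4 + \<dots>)\<close> with signs \<open>+, -, +, +\<close>. If all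
  \<open>x\<^sub>i - y\<^sub>j\<close> are large, a minor of order 4 has the sign of \<open>g\<^sub>0 g\<^sub>2 g\<^sub>3 g\<^sub>4 < 0\<close>.
\<close>


subsection \<open>Determinants of matrices given by functions\<close>

abbreviation kdet :: "nat \<Rightarrow> (nat \<Rightarrow> nat \<Rightarrow> real) \<Rightarrow> real" where
  "kdet n A \<equiv> Determinant.det (Matrix.mat n n (\<lambda>(i, j). A i j))"

lemma kdet_cong:
  assumes "\<And>i j. i < n \<Longrightarrow> j < n \<Longrightarrow> A i j = B i j"
  shows "kdet n A = kdet n B"
  by (rule arg_cong[of _ _ Determinant.det], rule eq_matI) (auto simp: assms)

lemma kdet_transpose: "kdet n (\<lambda>i j. A j i) = kdet n A"
proof -
  have "Matrix.mat n n (\<lambda>(i, j). A j i) = Matrix.transpose_mat (Matrix.mat n n (\<lambda>(i, j). A i j))"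
    by (rule eq_matI) auto
  then show ?thesis
    using det_transpose[of "Matrix.mat n n (\<lambda>(i, j). A i j)" n] by simp
qed

lemma kdet_Leibniz:
  "kdet n A = (\<Sum>p | p permutes {0..<n}. signof p * (\<Prod>i = 0..<n. A i (p i)))"
proof -
  have "(\<Prod>i = 0..<n. Matrix.mat n n (\<lambda>(i, j). A i j) $$ (i, p i)) = (\<Prod>i = 0..<n. A i (p i))"
    if "p permutes {0..<n}" for p
    using permutes_in_image[OF that] by (intro prod.cong) auto
  then show ?thesis
    by (subst det_def'[of _ n]) (auto intro!: sum.cong)
qed

lemma kdet_scale:
  "kdet n (\<lambda>i j. u i * v j * A i j) = (\<Prod>i<n. u i) * (\<Prod>j<n. v j) * kdet n A"
proof -
  have "(\<Prod>i = 0..<n. u i * v (p i) * A i (p i)) =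
      (\<Prod>i<n. u i) * (\<Prod>j<n. v j) * (\<Prod>i = 0..<n. A i (p i))"
    if "p permutes {0..<n}" for p
    using permutes_imp_bij[OF that] prod.reindex_bij_betw[of p "{0..<n}" "{0..<n}" v]
    by (simp add: prod.distrib lessThan_atLeast0)
  then show ?thesis
    unfolding kdet_Leibniz sum_distrib_left by (intro sum.cong) (auto simp: mult_ac)
qed

text \<open>Row and column factors come out as one positive number. The free factor \<open>c\<close>
  leaves room for the sign \<open>\<sigma>\<close> carried by
  \<open>product_minors_nonneg\<close>.\<close>

lemma kdet_scale_sign:
  assumes "\<And>i. i < n \<Longrightarrow> 0 < u i \<and> 0 < v i"
  shows "0 \<le> c * kdet n (\<lambda>i j. u i * v j * A i j) \<longleftrightarrow> 0 \<le> c * kdet n A"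
proof -
  have "0 < (\<Prod>i<n. u i) * (\<Prod>j<n. v j)"
    using assms by (intro mult_pos_pos prod_pos) auto
  moreover have "c * kdet n (\<lambda>i j. u i * v j * A i j) =
      (\<Prod>i<n. u i) * (\<Prod>j<n. v j) * (c * kdet n A)"
    unfolding kdet_scale by (simp only: mult_ac)
  ultimately show ?thesis
    using mult_le_cancel_left_pos[of "(\<Prod>i<n. u i) * (\<Prod>j<n. v j)" 0 "c * kdet n A"]
    by (simp only: mult_zero_right)
qed

lemma tendsto_kdet:
  assumes "\<And>i j. i < n \<Longrightarrow> j < n \<Longrightarrow> ((\<lambda>s. A s i j) \<longlongrightarrow> B i j) F"
  shows "((\<lambda>s. kdet n (A s)) \<longlongrightarrow> kdet n B) F"
proof -
  have "((\<lambda>s. \<Prod>i = 0..<n. A s i (p i)) \<longlongrightarrow> (\<Prod>i = 0..<n. B i (p i))) F"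
    if "p permutes {0..<n}" for p
    using permutes_in_image[OF that] by (intro tendsto_prod assms) auto
  then show ?thesis
    unfolding kdet_Leibniz by (intro tendsto_sum tendsto_mult tendsto_const) auto
qed

lemma kdet_identical_rows:
  assumes "i < n" "k < n" "i \<noteq> k" and "\<And>j. j < n \<Longrightarrow> A i j = A k j"
  shows "kdet n A = 0"
  by (rule det_identical_rows[of _ n i k]) (use assms in auto)

text \<open>The cofactors along row \<open>k\<close> do not see that row, so one vector
  \<open>c\<close> serves for all \<open>r\<close>. In this form the determinant can be
  differentiated, or passed to a limit, in the node of a single row.\<close>

lemma kdet_expand_row:
  assumes "k < n"
  obtains c where "\<And>r. kdet n (\<lambda>i j. if i = k then r j else A i j) = (\<Sum>j<n. r j * c j)"
proof
  fix r
  let ?B = "\<lambda>r. Matrix.mat n n (\<lambda>(i, j). if i = k then r j else A i j)"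
  have "cofactor (?B r) k j = cofactor (?B (A k)) k j" if "j < n" for j
    unfolding cofactor_def mat_delete_def using assms that
    by (intro arg_cong[where f = "\<lambda>x. _ * Determinant.det x"] eq_matI) auto
  then show "kdet n (\<lambda>i j. if i = k then r j else A i j) = (\<Sum>j<n. r j * cofactor (?B (A k)) k j)"
    using assms by (subst laplace_expansion_row[of _ n k]) (auto intro!: sum.cong)
qed

lemma kdet_single_column:
  assumes "k \<le> n" and "\<And>i. i \<le> n \<Longrightarrow> i \<noteq> k \<Longrightarrow> A i 0 = 0"
  shows "kdet (Suc n) A = (- 1) ^ k * A k 0 * kdet n (\<lambda>i j. A (if i < k then i else Suc i) (Suc j))"
proof -
  let ?A = "Matrix.mat (Suc n) (Suc n) (\<lambda>(i, j). A i j)"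
  have "mat_delete ?A k 0 = Matrix.mat n n (\<lambda>(i, j). A (if i < k then i else Suc i) (Suc j))"
    unfolding mat_delete_def using assms(1) by (intro eq_matI) auto
  then have minor: "cofactor ?A k 0 = (- 1) ^ k * kdet n (\<lambda>i j. A (if i < k then i else Suc i) (Suc j))"
    by (simp add: cofactor_def)
  have "kdet (Suc n) A = (\<Sum>i<Suc n. ?A $$ (i, 0) * cofactor ?A i 0)"
    by (rule laplace_expansion_column) auto
  also have "\<dots> = (\<Sum>i\<in>{k}. ?A $$ (i, 0) * cofactor ?A i 0)"
    by (rule sum.mono_neutral_right) (use assms in auto)
  finally show ?thesis
    using assms(1) by (simp add: minor)
qed

text \<open>Subtracting the last row from all others turns column 0 into (0, ..., 0, c); expanding
  along that column gives the sign.\<close>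

lemma kdet_constant_border:
  assumes row: "\<And>j. j \<le> n \<Longrightarrow> A n j = c" and col: "\<And>i. i \<le> n \<Longrightarrow> A i 0 = c"
  shows "kdet (Suc n) A = (- 1) ^ n * c * kdet n (\<lambda>i j. A i (Suc j) - c)"
proof -
  have sub: "kdet (Suc n) (\<lambda>i j. if i < k then A i j - c else A i j) = kdet (Suc n) A"
    if "k \<le> n" for k
    using that
  proof (induction k)
    case (Suc k)
    let ?B = "\<lambda>i j. if i < k then A i j - c else A i j"
    obtain d where d: "\<And>r. kdet (Suc n) (\<lambda>i j. if i = k then r j else ?B i j) = (\<Sum>j<Suc n. r j * d j)"
      using kdet_expand_row[of k "Suc n" ?B] Suc.prems by auto
    have "kdet (Suc n) (\<lambda>i j. if i < Suc k then A i j - c else A i j) =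
        kdet (Suc n) (\<lambda>i j. if i = k then A k j - c else ?B i j)"
      by (rule kdet_cong) auto
    also have "\<dots> = kdet (Suc n) (\<lambda>i j. if i = k then A k j else ?B i j) -
        kdet (Suc n) (\<lambda>i j. if i = k then c else ?B i j)"
      unfolding d using d[of "\<lambda>_. c"] by (simp add: left_diff_distrib sum_subtractf)
    \<comment> \<open>Row \<open>n\<close> is untouched so far, since \<open>k < n\<close>, and it
      consists of \<open>c\<close> only, just like the new row \<open>k\<close>.\<close>
    also have "kdet (Suc n) (\<lambda>i j. if i = k then c else ?B i j) = 0"
      by (rule kdet_identical_rows[of k _ n]) (use Suc.prems row in auto)
    also have "kdet (Suc n) (\<lambda>i j. if i = k then A k j else ?B i j) = kdet (Suc n) ?B"
      by (rule kdet_cong) auto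
    finally show ?case
      using Suc by simp
  qed simp
  have "kdet (Suc n) (\<lambda>i j. if i < n then A i j - c else A i j) =
      (- 1) ^ n * c * kdet n (\<lambda>i j. A i (Suc j) - c)"
    by (subst kdet_single_column[of n])
      (use row col in \<open>auto intro!: arg_cong[where f = "\<lambda>x. _ * x"] kdet_cong\<close>)
  then show ?thesis
    using sub[of n] by simp
qed

subsection \<open>Totally nonnegative difference kernels\<close>

text \<open>The minor condition of a Polya frequency function on its own, so that kernels can be
  smoothed without tracking integrability. For \<open>n = 0\<close> the determinant is 1.\<close>

definition tn_kernel :: "(real \<Rightarrow> real) \<Rightarrow> bool" where
  "tn_kernel f \<longleftrightarrow> (\<forall>n x y. strict_mono_on {..<n} x \<longrightarrow> strict_mono_on {..<n} y \<longrightarrow>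
     0 \<le> kdet n (\<lambda>i j. f (x i - y j)))"

lemma tn_kernel_cmult:
  assumes "tn_kernel f" "0 \<le> c"
  shows "tn_kernel (\<lambda>t. c * f t)"
  unfolding tn_kernel_def
proof (intro allI impI)
  fix n and x y :: "nat \<Rightarrow> real"
  assume "strict_mono_on {..<n} x" "strict_mono_on {..<n} y"
  then have "0 \<le> kdet n (\<lambda>i j. f (x i - y j))"
    using assms(1) by (simp add: tn_kernel_def)
  then show "0 \<le> kdet n (\<lambda>i j. c * f (x i - y j))"
    using kdet_scale[of n "\<lambda>_. c" "\<lambda>_. 1" "\<lambda>i j. f (x i - y j)"] assms(2) by simp
qed

text \<open>Negating the argument exchanges the roles of \<open>x\<close> and \<open>y\<close>,
  which transposes the matrix.\<close>

lemma tn_kernel_reflect: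
  assumes "tn_kernel f"
  shows "tn_kernel (\<lambda>t. f (- t))"
  unfolding tn_kernel_def
proof (intro allI impI)
  fix n and x y :: "nat \<Rightarrow> real"
  assume "strict_mono_on {..<n} x" "strict_mono_on {..<n} y"
  then have "0 \<le> kdet n (\<lambda>i j. f (y i - x j))"
    using assms by (simp add: tn_kernel_def)
  then show "0 \<le> kdet n (\<lambda>i j. f (- (x i - y j)))"
    using kdet_transpose[of n "\<lambda>i j. f (y i - x j)"] by simp
qed

text \<open>If \<open>x 1 \<le> y 0\<close>, the first two rows consist of ones and the determinant
  is 0. Otherwise column 0 vanishes below its top entry, and deleting the first row and column
  leaves a smaller matrix of the same kind.\<close>

lemma kdet_threshold_nonneg:
  fixes x y :: "nat \<Rightarrow> real"
  assumes "strict_mono_on {..<n} x" "strict_mono_on {..<n} y"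
  shows "0 \<le> kdet n (\<lambda>i j. of_bool (x i \<le> y j))"
  using assms
proof (induction n arbitrary: x y)
  case (Suc n)
  have x: "x i < x j" and y: "y i < y j" if "i < j" "j \<le> n" for i j
    using Suc.prems that by (auto simp: strict_mono_on_def)
  show ?case
  proof (cases "n > 0 \<and> x 1 \<le> y 0")
    case True
    have "x 0 \<le> y j \<and> x 1 \<le> y j" if "j \<le> n" for j
      using True x[of 0 1] y[of 0 j] that by (cases "j = 0") auto
    then have "kdet (Suc n) (\<lambda>i j. of_bool (x i \<le> y j)) = 0"
      using True by (intro kdet_identical_rows[of 0 _ 1]) auto
    then show ?thesis
      by simp
  next
    case False
    have "\<not> x i \<le> y 0" if "i \<le> n" "i \<noteq> 0" for i
      using False x[of 1 i] that by (cases "i = 1") auto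
    then have "kdet (Suc n) (\<lambda>i j. of_bool (x i \<le> y j)) =
        of_bool (x 0 \<le> y 0) * kdet n (\<lambda>i j. of_bool (x (Suc i) \<le> y (Suc j)))"
      by (subst kdet_single_column[of 0]) auto
    moreover have "0 \<le> kdet n (\<lambda>i j. of_bool (x (Suc i) \<le> y (Suc j)))"
      using x y by (intro Suc.IH) (auto simp: strict_mono_on_def)
    ultimately show ?thesis
      by simp
  qed
qed simp

text \<open>The exponential of \<open>a * (x i - y j)\<close> splits into positive row and column
  factors, which leaves the 0/1 threshold matrix.\<close>

lemma tn_kernel_one_sided_exp: "tn_kernel (\<lambda>t. exp (a * t) * of_bool (t \<le> 0))"
  unfolding tn_kernel_def
proof (intro allI impI)
  fix n and x y :: "nat \<Rightarrow> real"
  assume xy: "strict_mono_on {..<n} x" "strict_mono_on {..<n} y"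
  have "kdet n (\<lambda>i j. exp (a * (x i - y j)) * of_bool (x i - y j \<le> 0)) =
      kdet n (\<lambda>i j. exp (a * x i) * exp (- (a * y j)) * of_bool (x i \<le> y j))"
    by (rule kdet_cong) (simp add: right_diff_distrib exp_diff exp_minus divide_inverse)
  also have "\<dots> \<ge> 0"
    unfolding kdet_scale
    by (intro mult_nonneg_nonneg kdet_threshold_nonneg prod_nonneg xy) auto
  finally show "0 \<le> kdet n (\<lambda>i j. exp (a * (x i - y j)) * of_bool (x i - y j \<le> 0))" .
qed

text \<open>Finitely many points without a derivative are allowed in \<open>S\<close> because
  kernels with a kink or jump at 0 spoil differentiability of a minor at the nodes
  \<open>y j\<close>.\<close>

lemma nonneg_deriv_imp_le:
  fixes D :: "real \<Rightarrow> real"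
  assumes "a \<le> b" "continuous_on {a..b} D" "finite S"
    and der: "\<And>s. a < s \<Longrightarrow> s < b \<Longrightarrow> s \<notin> S \<Longrightarrow> (D has_real_derivative D' s) (at s)"
    and nonneg: "\<And>s. a < s \<Longrightarrow> s < b \<Longrightarrow> 0 \<le> D' s"
  shows "D a \<le> D b"
proof -
  have "((\<lambda>s. if a < s \<and> s < b then D' s else 0) has_integral (D b - D a)) {a..b}"
    by (rule fundamental_theorem_of_calculus_interior_strong[OF assms(3,1)])
      (use der assms(2) in \<open>auto simp: has_real_derivative_iff_has_vector_derivative\<close>)
  then have "0 \<le> D b - D a"
    by (rule has_integral_nonneg) (simp add: nonneg)
  then show ?thesis
    by simp
qed

text \<open>
  The rows built from \<open>f\<close> are replaced by rows built from \<open>h\<close> one at a time, from the top. As a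
  function of the node of the row being replaced, the new determinant times \<open>exp (a * s)\<close> has the
  old determinant as derivative up to a positive factor, and it vanishes when that node meets the
  previous one (for the first row: at \<open>-\<infinity>\<close>).
\<close>

lemma tn_kernel_smoothing:
  assumes tn: "tn_kernel f" and cont: "continuous_on UNIV h"
    and der: "\<And>t. t \<noteq> 0 \<Longrightarrow> (h has_real_derivative f t - a * h t) (at t)"
    and lim: "((\<lambda>t. exp (a * t) * h t) \<longlongrightarrow> 0) at_bot"
  shows "tn_kernel h"
  unfolding tn_kernel_def
proof (intro allI impI)
  fix n and x y :: "nat \<Rightarrow> real"
  assume x: "strict_mono_on {..<n} x" and y: "strict_mono_on {..<n} y"
  define W where "W k x = kdet n (\<lambda>i j. if i < k then h (x i - y j) else f (x i - y j))"
    for k and x :: "nat \<Rightarrow> real"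
  have "0 \<le> W k x" if "k \<le> n" "strict_mono_on {..<n} x" for k x
    using that
  proof (induction k arbitrary: x)
    case 0
    then show ?case
      using tn y by (simp add: W_def tn_kernel_def)
  next
    case (Suc k)
    have k: "k < n"
      using Suc.prems by simp
    have less: "x i < x j" if "i < j" "j < n" for i j
      using Suc.prems that by (auto simp: strict_mono_on_def)
    obtain c where c: "\<And>r. kdet n (\<lambda>i j. if i = k then r j else
        if i < k then h (x i - y j) else f (x i - y j)) = (\<Sum>j<n. r j * c j)"
      using kdet_expand_row[OF k, of "\<lambda>i j. if i < k then h (x i - y j) else f (x i - y j)"] by blast
    define D where "D s = exp (a * s) * (\<Sum>j<n. h (s - y j) * c j)" for s
    have Wh: "W (Suc k) (x(k := s)) = (\<Sum>j<n. h (s - y j) * c j)" for s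
      unfolding W_def c[symmetric] by (rule kdet_cong) auto
    have Wf: "W k (x(k := s)) = (\<Sum>j<n. f (s - y j) * c j)" for s
      unfolding W_def c[symmetric] by (rule kdet_cong) auto
    have cont_D: "continuous_on S D" for S
      unfolding D_def by (intro continuous_intros continuous_on_compose2[OF cont]) auto
    have der_D: "(D has_real_derivative exp (a * s) * W k (x(k := s))) (at s)" if "s \<notin> y ` {..<n}" for s
    proof -
      have *: "((\<lambda>s. h (s - y j)) has_real_derivative f (s - y j) - a * h (s - y j)) (at s)"
        if "j < n" for j
      proof -
        have "s - y j \<noteq> 0"
          using \<open>s \<notin> y ` {..<n}\<close> that by auto
        moreover have "((\<lambda>s. s - y j) has_real_derivative 1) (at s)"
          by (auto intro!: derivative_eq_intros)
        ultimately show ?thesis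
          using DERIV_chain2[OF der, of "\<lambda>s. s - y j" s 1 UNIV] by simp
      qed
      have "(D has_real_derivative exp (a * s) * a * (\<Sum>j<n. h (s - y j) * c j) +
          exp (a * s) * (\<Sum>j<n. (f (s - y j) - a * h (s - y j)) * c j)) (at s)"
        unfolding D_def by (auto intro!: derivative_eq_intros *)
      then show ?thesis
        unfolding Wf by (simp add: algebra_simps sum_subtractf sum_distrib_left)
    qed
    \<comment> \<open>While the node of row \<open>k\<close> moves between its predecessor and
      \<open>x k\<close>, the nodes stay strictly increasing, so the induction hypothesis applies to
      every intermediate position.\<close>
    have mono: "D s \<le> D (x k)" if s: "s \<le> x k" "\<And>i. i < k \<Longrightarrow> x i \<le> s" for s
    proof (rule nonneg_deriv_imp_le[OF s(1) cont_D _ der_D])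
      fix t assume t: "s < t" "t < x k"
      have "strict_mono_on {..<n} (x(k := t))"
      proof (rule strict_mono_onI)
        fix i j assume ij: "i \<in> {..<n}" "j \<in> {..<n}" "i < j"
        have "x i < t" if "j = k"
          using s(2)[of i] t that ij by auto
        moreover have "t < x j" if "i = k"
          using less[of k j] t that ij by auto
        ultimately show "(x(k := t)) i < (x(k := t)) j"
          using less[of i j] ij by auto
      qed
      then show "0 \<le> exp (a * t) * W k (x(k := t))"
        using Suc.IH k by (simp add: less_imp_le)
    qed auto
    have "0 \<le> D (x k)"
    proof (cases "k = 0")
      case True
      \<comment> \<open>Extracting the constant \<open>exp (a * y j)\<close> from each summand of
        \<open>D s\<close> leaves the expression of \<open>lim\<close> at the shifted point
        \<open>s - y j\<close>.\<close>
      have "((\<lambda>s. \<Sum>j<n. exp (a * y j) * c j * (exp (a * (s - y j)) * h (s - y j))) \<longlongrightarrow>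
          (\<Sum>j<n. exp (a * y j) * c j * 0)) at_bot"
      proof (intro tendsto_intros)
        fix j
        have "LIM s at_bot. s - y j :> at_bot"
          unfolding filterlim_at_bot
        proof
          fix Z
          show "eventually (\<lambda>s. s - y j \<le> Z) at_bot"
            using eventually_le_at_bot[of "Z + y j"] by eventually_elim simp
        qed
        then show "((\<lambda>s. exp (a * (s - y j)) * h (s - y j)) \<longlongrightarrow> 0) at_bot"
          by (rule filterlim_compose[OF lim])
      qed
      moreover have "(\<Sum>j<n. exp (a * y j) * c j * (exp (a * (s - y j)) * h (s - y j))) = D s" for s
        unfolding D_def sum_distrib_left
        by (intro sum.cong) (simp_all add: right_diff_distrib exp_diff)
      ultimately have "(D \<longlongrightarrow> 0) at_bot"
        by simp
      moreover have "eventually (\<lambda>s. D s \<le> D (x k)) at_bot"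
        using eventually_le_at_bot[of "x k"] by eventually_elim (use mono True in auto)
      ultimately show ?thesis
        by (intro tendsto_upperbound) auto
    next
      case False
      have "W (Suc k) (x(k := x (k - 1))) = 0"
        unfolding W_def using k False by (intro kdet_identical_rows[of k n "k - 1"]) auto
      then have "D (x (k - 1)) = 0"
        unfolding D_def Wh by simp
      moreover have "D (x (k - 1)) \<le> D (x k)"
      proof (rule mono)
        show "x (k - 1) \<le> x k"
          using less[of "k - 1" k] k False by auto
        show "x i \<le> x (k - 1)" if "i < k" for i
        proof (cases "i = k - 1")
          case False
          then have "i < k - 1"
            using that by simp
          moreover have "k - 1 < n"
            using k by simp
          ultimately have "x i < x (k - 1)"
            by (rule less)
          then show ?thesis
            by simp
        qed simp
      qed
      ultimately show ?thesis
        by simp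
    qed
    then show ?case
      using Wh[of "x k"] by (simp add: D_def zero_le_mult_iff)
  qed
  from this[of n x] show "0 \<le> kdet n (\<lambda>i j. h (x i - y j))"
    using x unfolding W_def by (simp cong: kdet_cong)
qed

subsection \<open>Minors of product kernels near the origin\<close>

definition product_minors_nonneg :: "real \<Rightarrow> nat \<Rightarrow> (real \<Rightarrow> real) \<Rightarrow> bool" where
  "product_minors_nonneg \<sigma> n G \<longleftrightarrow>
     (\<forall>u v. (\<forall>i<n. 0 < u i \<and> u i \<le> 1 \<and> 0 < v i \<and> v i \<le> 1) \<longrightarrow>
        strict_antimono_on {..<n} u \<longrightarrow> strict_mono_on {..<n} v \<longrightarrow>
        0 \<le> \<sigma> * kdet n (\<lambda>i j. G (u i * v j)))"

text \<open>
  Letting the smallest \<open>u\<close> and the smallest \<open>v\<close> tend to 0 makes the last row and the first column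
  constantly \<open>c\<close>; the remaining rows are then reduced by the last one.
\<close>

lemma product_minors_nonneg_step:
  assumes G: "product_minors_nonneg \<sigma> (Suc n) G"
    and eq: "\<And>t. G t = c + t ^ m * H t" and m: "0 < m" and cont: "continuous_on UNIV H"
  shows "product_minors_nonneg (\<sigma> * (- 1) ^ n * c) n H"
  unfolding product_minors_nonneg_def
proof (intro allI impI)
  fix u v :: "nat \<Rightarrow> real"
  assume uv: "\<forall>i<n. 0 < u i \<and> u i \<le> 1 \<and> 0 < v i \<and> v i \<le> 1"
    and u: "strict_antimono_on {..<n} u" and v: "strict_mono_on {..<n} v"
  \<comment> \<open>The small node \<open>s\<close> comes last in the decreasing \<open>U s\<close>
    and first in the increasing \<open>V s\<close>. At \<open>s = 0\<close> row \<open>n\<close> and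
    column 0 therefore have the entry \<open>G 0 = c\<close>.\<close>
  define U where "U s i = (if i < n then u i else s)" for s i
  define V where "V s j = (case j of 0 \<Rightarrow> s | Suc j \<Rightarrow> v j)" for s j
  have "eventually (\<lambda>s. s < 1 \<and> (\<forall>i\<in>{..<n}. s < u i \<and> s < v i)) (at_right 0)"
    using uv by (intro eventually_conj eventually_ball_finite ballI)
      (auto simp: eventually_at_right_field intro: exI[of _ 1])
  then have "eventually (\<lambda>s. 0 \<le> \<sigma> * kdet (Suc n) (\<lambda>i j. G (U s i * V s j))) (at_right 0)"
    using eventually_at_right_less[of 0]
  proof eventually_elim
    case (elim s)
    have "\<forall>i<Suc n. 0 < U s i \<and> U s i \<le> 1 \<and> 0 < V s i \<and> V s i \<le> 1"
      using elim uv by (auto simp: U_def V_def split: nat.splits)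
    moreover have "strict_antimono_on {..<Suc n} (U s)"
      using elim u by (auto simp: U_def monotone_on_def)
    moreover have "strict_mono_on {..<Suc n} (V s)"
      using elim v by (auto simp: V_def monotone_on_def split: nat.splits)
    ultimately show ?case
      using G by (simp add: product_minors_nonneg_def)
  qed
  moreover have "((\<lambda>s. \<sigma> * kdet (Suc n) (\<lambda>i j. G (U s i * V s j))) \<longlongrightarrow>
      \<sigma> * kdet (Suc n) (\<lambda>i j. G (U 0 i * V 0 j))) (at_right 0)"
  proof (intro tendsto_mult tendsto_const tendsto_kdet)
    fix i j
    have "continuous_on UNIV G"
      unfolding eq by (intro continuous_intros cont)
    then have "isCont G x" for x
      by (simp add: continuous_on_eq_continuous_at)
    have "((\<lambda>s. U s i) \<longlongrightarrow> U 0 i) (at_right 0)" "((\<lambda>s. V s j) \<longlongrightarrow> V 0 j) (at_right 0)"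
      by (cases "i < n"; simp add: U_def) (cases j; simp add: V_def)
    from tendsto_mult[OF this] have "((\<lambda>s. U s i * V s j) \<longlongrightarrow> U 0 i * V 0 j) (at_right 0)" .
    with \<open>\<And>x. isCont G x\<close> show "((\<lambda>s. G (U s i * V s j)) \<longlongrightarrow> G (U 0 i * V 0 j)) (at_right 0)"
      by (rule isCont_tendsto_compose)
  qed
  ultimately have "0 \<le> \<sigma> * kdet (Suc n) (\<lambda>i j. G (U 0 i * V 0 j))"
    by (intro tendsto_lowerbound) auto
  also have "kdet (Suc n) (\<lambda>i j. G (U 0 i * V 0 j)) =
      (- 1) ^ n * c * kdet n (\<lambda>i j. G (U 0 i * V 0 (Suc j)) - c)"
    by (rule kdet_constant_border) (use m in \<open>auto simp: U_def V_def eq\<close>)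
  \<comment> \<open>What remains is \<open>t ^ m * H t\<close> at \<open>t = u i * v j\<close>,
    whose power of \<open>t\<close> splits into positive row and column factors.\<close>
  also have "kdet n (\<lambda>i j. G (U 0 i * V 0 (Suc j)) - c) =
      kdet n (\<lambda>i j. u i ^ m * v j ^ m * H (u i * v j))"
    by (rule kdet_cong) (auto simp: U_def V_def eq power_mult_distrib)
  finally have "0 \<le> \<sigma> * (- 1) ^ n * c * kdet n (\<lambda>i j. u i ^ m * v j ^ m * H (u i * v j))"
    by (simp only: mult_ac)
  then show "0 \<le> \<sigma> * (- 1) ^ n * c * kdet n (\<lambda>i j. H (u i * v j))"
    by (subst (asm) kdet_scale_sign) (use uv in auto)
qed

text \<open>One more factor 7 - 5 t^2 + 2 t^3 preserves the sign pattern, since each new coefficient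
  is a sum of two terms of the required sign. The induction starts at 2 because the first power has
  no t^4 term. The nested form is the one consumed by
  \<open>product_minors_nonneg_step\<close>.\<close>

lemma cubic_power_expansion:
  assumes "2 \<le> n"
  shows "\<exists>g0 g2 g3 g4 :: real. \<exists>R. 0 < g0 \<and> g2 < 0 \<and> 0 < g3 \<and> 0 < g4 \<and> continuous_on UNIV R \<and>
    (\<forall>t. (7 - 5 * t\<^sup>2 + 2 * t ^ 3) ^ n = g0 + t\<^sup>2 * (g2 + t * (g3 + t * (g4 + t * R t))))"
  using assms
proof (induction n rule: dec_induct)
  case base
  have "(7 - 5 * t\<^sup>2 + 2 * t ^ 3)\<^sup>2 =
      49 + t\<^sup>2 * (- 70 + t * (28 + t * (25 + t * (- 20 + 4 * t))))" for t :: real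
    by (simp add: power2_eq_square power3_eq_cube algebra_simps)
  moreover have "continuous_on UNIV (\<lambda>t :: real. - 20 + 4 * t)"
    by (intro continuous_intros)
  ultimately show ?case
    by (intro exI[of _ 49] exI[of _ "- 70"] exI[of _ 28] exI[of _ 25] exI[of _ "\<lambda>t. - 20 + 4 * t"]) simp
next
  case (step n)
  then obtain g0 g2 g3 g4 :: real and R where g: "0 < g0" "g2 < 0" "0 < g3" "0 < g4"
    and R: "continuous_on UNIV R"
    and eq: "\<And>t. (7 - 5 * t\<^sup>2 + 2 * t ^ 3) ^ n = g0 + t\<^sup>2 * (g2 + t * (g3 + t * (g4 + t * R t)))"
    by blast
  \<comment> \<open>\<open>R'\<close> gathers all contributions of order t^5 and higher.\<close>
  define R' where "R' t = 7 * R t - 5 * (g3 + t * (g4 + t * R t)) + 2 * (g2 + t * (g3 + t * (g4 + t * R t)))" for t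
  have "(7 - 5 * t\<^sup>2 + 2 * t ^ 3) ^ Suc n = 7 * g0 + t\<^sup>2 * ((7 * g2 - 5 * g0) +
      t * ((7 * g3 + 2 * g0) + t * ((7 * g4 - 5 * g2) + t * R' t)))" for t
    unfolding power_Suc eq R'_def by (simp add: power2_eq_square power3_eq_cube algebra_simps)
  moreover have "continuous_on UNIV R'"
    unfolding R'_def by (intro continuous_intros R)
  ultimately show ?case
    using g by (intro exI[of _ "7 * g0"] exI[of _ "7 * g2 - 5 * g0"] exI[of _ "7 * g3 + 2 * g0"]
        exI[of _ "7 * g4 - 5 * g2"] exI[of _ R']) auto
qed

text \<open>Splitting off \<open>g0\<close>, \<open>g2\<close>, \<open>g3\<close>, \<open>g4\<close>
  in turn, with \<open>m\<close> equal to 2, 1, 1, 1, lowers the order from 4 to 0. The signs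
  (-1)^3, (-1)^2, (-1)^1, (-1)^0 multiply to 1, so the accumulated \<sigma> is the negative product
  of the four coefficients.\<close>

lemma cubic_power_not_product_minors_nonneg:
  assumes "2 \<le> n"
  shows "\<not> product_minors_nonneg 1 4 (\<lambda>t. (7 - 5 * t\<^sup>2 + 2 * t ^ 3) ^ n)"
proof
  assume *: "product_minors_nonneg 1 4 (\<lambda>t. (7 - 5 * t\<^sup>2 + 2 * t ^ 3) ^ n)"
  obtain g0 g2 g3 g4 :: real and R where g: "0 < g0" "g2 < 0" "0 < g3" "0 < g4"
    and R: "continuous_on UNIV R"
    and eq: "\<And>t. (7 - 5 * t\<^sup>2 + 2 * t ^ 3) ^ n = g0 + t\<^sup>2 * (g2 + t * (g3 + t * (g4 + t * R t)))"
    using cubic_power_expansion[OF assms] by blast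
  have "product_minors_nonneg 1 (Suc 3) (\<lambda>t. g0 + t\<^sup>2 * (g2 + t * (g3 + t * (g4 + t * R t))))"
    using * unfolding eq by (simp add: eval_nat_numeral)
  then have "product_minors_nonneg (1 * (- 1) ^ 3 * g0) 3 (\<lambda>t. g2 + t * (g3 + t * (g4 + t * R t)))"
    by (rule product_minors_nonneg_step) (auto intro!: continuous_intros R)
  then have "product_minors_nonneg (- g0) (Suc 2) (\<lambda>t. g2 + t * (g3 + t * (g4 + t * R t)))"
    by simp
  then have "product_minors_nonneg (- g0 * (- 1)\<^sup>2 * g2) 2 (\<lambda>t. g3 + t * (g4 + t * R t))"
    by (rule product_minors_nonneg_step[where m = 1]) (auto intro!: continuous_intros R)
  then have "product_minors_nonneg (- g0 * g2) (Suc 1) (\<lambda>t. g3 + t * (g4 + t * R t))"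
    by (simp add: numeral_2_eq_2)
  then have "product_minors_nonneg (- g0 * g2 * (- 1) ^ 1 * g3) 1 (\<lambda>t. g4 + t * R t)"
    by (rule product_minors_nonneg_step[where m = 1]) (auto intro!: continuous_intros R)
  then have "product_minors_nonneg (g0 * g2 * g3) (Suc 0) (\<lambda>t. g4 + t * R t)"
    by simp
  then have "product_minors_nonneg (g0 * g2 * g3 * (- 1) ^ 0 * g4) 0 R"
    by (rule product_minors_nonneg_step[where m = 1]) (auto intro!: R)
  \<comment> \<open>The determinant of order 0 is 1, so the condition of order 0 says that \<sigma>
    itself is nonnegative.\<close>
  then have "0 \<le> g0 * g2 * g3 * g4"
    by (simp add: product_minors_nonneg_def monotone_on_def)
  moreover have "g0 * g2 * g3 * g4 < 0"
    using g by (simp add: mult_pos_neg mult_neg_pos)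
  ultimately show False
    by simp
qed

subsection \<open>The witness\<close>

lemma tendsto_exp_mult_bounded:
  fixes h :: "real \<Rightarrow> real"
  assumes "0 < a" "\<And>t. \<bar>h t\<bar> \<le> C"
  shows "((\<lambda>t. exp (a * t) * h t) \<longlongrightarrow> 0) at_bot"
proof (rule Lim_null_comparison)
  show "eventually (\<lambda>t. norm (exp (a * t) * h t) \<le> exp (a * t) * C) at_bot"
    using assms(2) by (simp add: abs_mult)
  have "((\<lambda>t. exp (a * t)) \<longlongrightarrow> 0) at_bot"
    by (intro filterlim_compose[OF exp_at_bot]
        filterlim_tendsto_pos_mult_at_bot[OF tendsto_const assms(1) filterlim_ident])
  then show "((\<lambda>t. exp (a * t) * C) \<longlongrightarrow> 0) at_bot"
    by (rule tendsto_mult_left_zero)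
qed

text \<open>
  Here \<open>f = a\<^sup>2 g - g''\<close>, factored as \<open>(a + d/dt) (a - d/dt) g\<close>: one smoothing step gives \<open>a g - g'\<close>,
  and a second one, after a reflection, gives \<open>g\<close>.
\<close>

lemma tn_kernel_smoothing_even:
  assumes tn: "tn_kernel f" and a: "0 < a"
    and cont: "continuous_on UNIV g" "continuous_on UNIV g'"
    and bounded: "\<And>t. \<bar>g t\<bar> \<le> B" "\<And>t. \<bar>g' t\<bar> \<le> B"
    and der: "\<And>t. t \<noteq> 0 \<Longrightarrow> (g has_real_derivative g' t) (at t)"
      "\<And>t. t \<noteq> 0 \<Longrightarrow> (g' has_real_derivative a\<^sup>2 * g t - f t) (at t)"
  shows "tn_kernel g"
proof -
  have "tn_kernel (\<lambda>t. a * g t - g' t)"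
  proof (rule tn_kernel_smoothing[OF tn])
    show "continuous_on UNIV (\<lambda>t. a * g t - g' t)"
      by (intro continuous_intros cont)
    show "((\<lambda>t. a * g t - g' t) has_real_derivative f t - a * (a * g t - g' t)) (at t)" if "t \<noteq> 0" for t
      using der[OF that] by (auto intro!: derivative_eq_intros simp: power2_eq_square algebra_simps)
    show "((\<lambda>t. exp (a * t) * (a * g t - g' t)) \<longlongrightarrow> 0) at_bot"
    proof (rule tendsto_exp_mult_bounded[OF a])
      fix t
      have "\<bar>a * g t - g' t\<bar> \<le> a * \<bar>g t\<bar> + \<bar>g' t\<bar>"
        using abs_triangle_ineq4[of "a * g t" "g' t"] a by (simp add: abs_mult)
      also have "\<dots> \<le> a * B + B"
        by (intro add_mono mult_left_mono bounded) (use a in simp)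
      finally show "\<bar>a * g t - g' t\<bar> \<le> a * B + B" .
    qed
  qed
  then have "tn_kernel (\<lambda>t. a * g (- t) - g' (- t))"
    using tn_kernel_reflect by fastforce
  then have "tn_kernel (\<lambda>t. g (- t))"
  proof (rule tn_kernel_smoothing)
    show "continuous_on UNIV (\<lambda>t. g (- t))"
      by (rule continuous_on_compose2[OF cont(1)]) (auto intro!: continuous_intros)
    show "((\<lambda>t. g (- t)) has_real_derivative a * g (- t) - g' (- t) - a * g (- t)) (at t)" if "t \<noteq> 0" for t
    proof -
      have "(uminus has_real_derivative - 1) (at t)"
        by (auto intro!: derivative_eq_intros)
      then show ?thesis
        using DERIV_chain2[OF der(1), of uminus t "- 1" UNIV] that by simp
    qed
    show "((\<lambda>t. exp (a * t) * g (- t)) \<longlongrightarrow> 0) at_bot"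
      by (rule tendsto_exp_mult_bounded[OF a]) (rule bounded(1))
  qed
  then show ?thesis
    using tn_kernel_reflect by fastforce
qed

section \<open>Calculus of exp (-|t|) away from its kink\<close>

definition exp_abs :: "real \<Rightarrow> real" where
  "exp_abs t = exp (- \<bar>t\<bar>)"

lemma exp_abs_bounds: "0 < exp_abs t" "exp_abs t \<le> 1"
  by (auto simp: exp_abs_def)

lemma continuous_on_exp_abs [continuous_intros]: "continuous_on S exp_abs"
  unfolding exp_abs_def by (intro continuous_intros)

lemma has_real_derivative_exp_abs:
  assumes "t \<noteq> 0"
  shows "(exp_abs has_real_derivative - sgn t * exp_abs t) (at t)"
proof (cases "0 < t")
  case True
  have "((\<lambda>t. exp (- t)) has_real_derivative - exp (- t)) (at t)"
    by (auto intro!: derivative_eq_intros)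
  then show ?thesis
    using True
    by (auto simp: exp_abs_def elim!: has_field_derivative_transform_within_open[where S = "{0<..}"])
next
  case False
  then have "t < 0"
    using assms by simp
  have "(exp has_real_derivative exp t) (at t)"
    by (rule DERIV_exp)
  then have "(exp_abs has_real_derivative exp t) (at t)"
    by (rule has_field_derivative_transform_within_open[where S = "{..<0}"])
      (use \<open>t < 0\<close> in \<open>auto simp: exp_abs_def\<close>)
  then show ?thesis
    using \<open>t < 0\<close> by (simp add: exp_abs_def)
qed

lemma has_real_derivative_sgn_mult:
  fixes p :: "real \<Rightarrow> real"
  assumes "t \<noteq> 0" "(p has_real_derivative d) (at t)"
  shows "((\<lambda>t. sgn t * p t) has_real_derivative sgn t * d) (at t)"
proof -
  have "((\<lambda>s. sgn t * p s) has_real_derivative sgn t * d) (at t)"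
    using assms(2) by (rule DERIV_cmult)
  then show ?thesis
    by (rule has_field_derivative_transform_within_open[where S = "if 0 < t then {0<..} else {..<0}"])
      (use assms(1) in \<open>auto split: if_splits\<close>)
qed

text \<open>The zero of \<open>p\<close> at 0 cancels the jump of \<open>sgn\<close>. This gives the
  continuity at 0 of the derivatives \<open>g'\<close> of the even kernels below.\<close>

lemma continuous_on_sgn_mult:
  fixes p :: "real \<Rightarrow> real"
  assumes "continuous_on UNIV p" "p 0 = 0"
  shows "continuous_on UNIV (\<lambda>t. sgn t * p t)"
proof -
  have "continuous_on UNIV (\<lambda>t. if t \<le> 0 then - p t else p t)"
    by (rule continuous_on_cases_le)
      (use assms in \<open>auto intro!: continuous_intros intro: continuous_on_subset\<close>)
  then show ?thesis
    by (rule continuous_on_eq) (use assms(2) in \<open>auto simp: sgn_if\<close>)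
qed

text \<open>For h = exp (-4 |t|), h' + 4 h is 0 on the right of 0 and 8 exp (4 t) on the left, so
  one smoothing of the one-sided exponential suffices.\<close>

lemma tn_kernel_exp_abs_4: "tn_kernel (\<lambda>t. exp_abs t ^ 4)"
proof -
  have "tn_kernel (\<lambda>t. 8 * (exp (4 * t) * of_bool (t \<le> 0)))"
    by (intro tn_kernel_cmult tn_kernel_one_sided_exp) simp
  then show ?thesis
  proof (rule tn_kernel_smoothing)
    show "continuous_on UNIV (\<lambda>t. exp_abs t ^ 4)"
      by (intro continuous_intros)
    show "((\<lambda>t. exp_abs t ^ 4) has_real_derivative
        8 * (exp (4 * t) * of_bool (t \<le> 0)) - 4 * exp_abs t ^ 4) (at t)" if "t \<noteq> 0" for t
    proof -
      have "((\<lambda>t. exp_abs t ^ 4) has_real_derivative - 4 * sgn t * exp_abs t ^ 4) (at t)"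
        using has_real_derivative_exp_abs[OF that]
        by (auto intro!: derivative_eq_intros simp: eval_nat_numeral)
      moreover have "exp_abs t ^ 4 = exp (4 * t)" if "t < 0"
        using that by (simp add: exp_abs_def flip: exp_of_nat_mult)
      ultimately show ?thesis
        using that by (cases "0 < t") auto
    qed
    show "((\<lambda>t. exp (4 * t) * exp_abs t ^ 4) \<longlongrightarrow> 0) at_bot"
      by (rule tendsto_exp_mult_bounded[where C = 1])
        (simp_all add: exp_abs_bounds less_imp_le power_le_one)
  qed
qed

text \<open>With q = exp (-|t|), off 0 the operator 9 - d^2/dt^2 kills q^3 and multiplies q^4 by 9 -
  16, giving 21 q^4. The ratio 4 : -3 makes the one-sided derivatives at 0 vanish, so that
  \<open>g'\<close> is continuous.\<close>

lemma tn_kernel_exp_abs_3_4: "tn_kernel (\<lambda>t. 4 * exp_abs t ^ 3 - 3 * exp_abs t ^ 4)"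
proof -
  have "tn_kernel (\<lambda>t. 21 * exp_abs t ^ 4)"
    by (intro tn_kernel_cmult tn_kernel_exp_abs_4) simp
  then show ?thesis
  proof (rule tn_kernel_smoothing_even[where a = 3 and B = 12
        and g' = "\<lambda>t. sgn t * (12 * exp_abs t ^ 4 - 12 * exp_abs t ^ 3)"])
    fix t :: real
    have q: "0 \<le> exp_abs t ^ n" "exp_abs t ^ n \<le> 1" for n
      using exp_abs_bounds[of t] by (auto intro: power_le_one)
    show "\<bar>4 * exp_abs t ^ 3 - 3 * exp_abs t ^ 4\<bar> \<le> 12"
      using q[of 3] q[of 4] by linarith
    have "\<bar>12 * exp_abs t ^ 4 - 12 * exp_abs t ^ 3\<bar> \<le> 12"
      using q[of 3] q[of 4] by linarith
    then show "\<bar>sgn t * (12 * exp_abs t ^ 4 - 12 * exp_abs t ^ 3)\<bar> \<le> 12"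
      by (simp add: abs_mult sgn_if)
    assume t: "t \<noteq> 0"
    note der = has_real_derivative_exp_abs[OF t]
    show "((\<lambda>t. 4 * exp_abs t ^ 3 - 3 * exp_abs t ^ 4) has_real_derivative
        sgn t * (12 * exp_abs t ^ 4 - 12 * exp_abs t ^ 3)) (at t)"
      by (rule derivative_eq_intros der refl)+ (simp add: eval_nat_numeral algebra_simps)
    have "((\<lambda>t. 12 * exp_abs t ^ 4 - 12 * exp_abs t ^ 3) has_real_derivative
        sgn t * (36 * exp_abs t ^ 3 - 48 * exp_abs t ^ 4)) (at t)"
      by (rule derivative_eq_intros der refl)+ (simp add: eval_nat_numeral algebra_simps)
    then show "((\<lambda>t. sgn t * (12 * exp_abs t ^ 4 - 12 * exp_abs t ^ 3)) has_real_derivative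
        3\<^sup>2 * (4 * exp_abs t ^ 3 - 3 * exp_abs t ^ 4) - 21 * exp_abs t ^ 4) (at t)"
      by (intro DERIV_cong[OF has_real_derivative_sgn_mult[OF t]])
        (use t in \<open>auto simp: sgn_if\<close>)
  qed (auto intro!: continuous_intros continuous_on_sgn_mult simp: exp_abs_def)
qed

definition polya_witness :: "real \<Rightarrow> real" where
  "polya_witness t = 7 * exp_abs t - 5 * exp_abs t ^ 3 + 2 * exp_abs t ^ 4"

text \<open>Off 0 the operator 1 - d^2/dt^2 kills q and multiplies q^3 and q^4 by -8 and -15, so -5
  q^3 + 2 q^4 yields 10 times the previous kernel. The coefficient 7 = 15 - 8 of q makes
  \<open>g'\<close> vanish at 0.\<close>

lemma tn_kernel_polya_witness: "tn_kernel polya_witness"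
  unfolding polya_witness_def
proof -
  have "tn_kernel (\<lambda>t. 10 * (4 * exp_abs t ^ 3 - 3 * exp_abs t ^ 4))"
    by (intro tn_kernel_cmult tn_kernel_exp_abs_3_4) simp
  then show "tn_kernel (\<lambda>t. 7 * exp_abs t - 5 * exp_abs t ^ 3 + 2 * exp_abs t ^ 4)"
  proof (rule tn_kernel_smoothing_even[where a = 1 and B = 15
        and g' = "\<lambda>t. sgn t * (15 * exp_abs t ^ 3 - 7 * exp_abs t - 8 * exp_abs t ^ 4)"])
    fix t :: real
    have q: "0 \<le> exp_abs t ^ n" "exp_abs t ^ n \<le> 1" for n
      using exp_abs_bounds[of t] by (auto intro: power_le_one)
    show "\<bar>7 * exp_abs t - 5 * exp_abs t ^ 3 + 2 * exp_abs t ^ 4\<bar> \<le> 15"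
      using exp_abs_bounds[of t] q[of 3] q[of 4] by linarith
    have "\<bar>15 * exp_abs t ^ 3 - 7 * exp_abs t - 8 * exp_abs t ^ 4\<bar> \<le> 15"
      using exp_abs_bounds[of t] q[of 3] q[of 4] by linarith
    then show "\<bar>sgn t * (15 * exp_abs t ^ 3 - 7 * exp_abs t - 8 * exp_abs t ^ 4)\<bar> \<le> 15"
      by (simp add: abs_mult sgn_if)
    assume t: "t \<noteq> 0"
    note der = has_real_derivative_exp_abs[OF t]
    show "((\<lambda>t. 7 * exp_abs t - 5 * exp_abs t ^ 3 + 2 * exp_abs t ^ 4) has_real_derivative
        sgn t * (15 * exp_abs t ^ 3 - 7 * exp_abs t - 8 * exp_abs t ^ 4)) (at t)"
      by (rule derivative_eq_intros der refl)+ (simp add: eval_nat_numeral algebra_simps)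
    have "((\<lambda>t. 15 * exp_abs t ^ 3 - 7 * exp_abs t - 8 * exp_abs t ^ 4) has_real_derivative
        sgn t * (7 * exp_abs t - 45 * exp_abs t ^ 3 + 32 * exp_abs t ^ 4)) (at t)"
      by (rule derivative_eq_intros der refl)+ (simp add: eval_nat_numeral algebra_simps)
    then show "((\<lambda>t. sgn t * (15 * exp_abs t ^ 3 - 7 * exp_abs t - 8 * exp_abs t ^ 4)) has_real_derivative
        1\<^sup>2 * (7 * exp_abs t - 5 * exp_abs t ^ 3 + 2 * exp_abs t ^ 4) -
        10 * (4 * exp_abs t ^ 3 - 3 * exp_abs t ^ 4)) (at t)"
      by (intro DERIV_cong[OF has_real_derivative_sgn_mult[OF t]])
        (use t in \<open>auto simp: sgn_if\<close>)
  qed (auto intro!: continuous_intros continuous_on_sgn_mult simp: exp_abs_def)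
qed

section \<open>Positivity, integrability and monotonicity of the witness\<close>

lemma polya_witness_factor:
  "polya_witness t = exp_abs t * (7 - 5 * (exp_abs t)\<^sup>2 + 2 * exp_abs t ^ 3)"
  by (simp add: polya_witness_def eval_nat_numeral algebra_simps)

lemma polya_witness_pos: "0 < polya_witness t"
proof -
  have "(exp_abs t)\<^sup>2 \<le> 1" "0 \<le> exp_abs t ^ 3"
    using exp_abs_bounds[of t] by (auto intro: power_le_one)
  then have "0 < 7 - 5 * (exp_abs t)\<^sup>2 + 2 * exp_abs t ^ 3"
    by linarith
  then show ?thesis
    unfolding polya_witness_factor using exp_abs_bounds(1) by (rule mult_pos_pos[rotated])
qed

lemma continuous_on_polya_witness: "continuous_on S polya_witness"
  unfolding polya_witness_def by (intro continuous_intros)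

lemma polya_witness_even: "polya_witness (- t) = polya_witness t"
  by (simp add: polya_witness_def exp_abs_def)

lemma integrable_exp_abs: "integrable lebesgue exp_abs"
proof -
  define f :: "real \<Rightarrow> real" where "f = (\<lambda>x. indicator {0..} x * exp (- x))"
  have "(\<lambda>x. exp (- x)) absolutely_integrable_on {0 :: real..}"
    using integrable_on_exp_minus_to_infinity[of 1 0]
    by (intro nonnegative_absolutely_integrable_1) auto
  then have "integrable lebesgue f"
    by (simp add: set_integrable_def f_def)
  moreover have "f \<in> borel_measurable borel"
    unfolding f_def by measurable
  ultimately have f: "integrable lborel f"
    by (simp add: integrable_completion)
  then have "integrable lborel (\<lambda>x. f (0 + (- 1) * x))"
    by (rule lborel_integrable_real_affine) simp
  with f have "integrable lborel (\<lambda>x. f x + f (- x))"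
    by simp
  \<comment> \<open>The sum \<open>f x + f (- x)\<close> agrees with \<open>exp_abs x\<close> except
    at 0, where it is 2; hence domination rather than equality.\<close>
  then have "integrable lborel exp_abs"
    by (rule Bochner_Integration.integrable_bound)
      (auto simp: f_def exp_abs_def indicator_def intro!: borel_measurable_continuous_onI continuous_intros)
  then show ?thesis
    by (rule integrable_completion[THEN iffD2, rotated])
      (auto intro!: borel_measurable_continuous_onI continuous_intros)
qed

lemma integrable_polya_witness: "integrable lebesgue polya_witness"
proof (rule Bochner_Integration.integrable_bound)
  show "integrable lebesgue (\<lambda>t. 9 * exp_abs t)"
    using integrable_exp_abs by simp
  show "polya_witness \<in> borel_measurable lebesgue"
    by (rule measurable_completion)
      (simp add: borel_measurable_continuous_onI continuous_on_polya_witness)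
  have "polya_witness t \<le> 9 * exp_abs t" for t
  proof -
    have "exp_abs t ^ 3 \<le> 1"
      using exp_abs_bounds[of t] by (auto intro: power_le_one)
    then have "7 - 5 * (exp_abs t)\<^sup>2 + 2 * exp_abs t ^ 3 \<le> 9"
      using zero_le_power2[of "exp_abs t"] by linarith
    then show ?thesis
      unfolding polya_witness_factor
      using mult_left_mono[of _ 9 "exp_abs t"] exp_abs_bounds(1)[of t] by (simp add: mult.commute)
  qed
  then show "AE t in lebesgue. norm (polya_witness t) \<le> norm (9 * exp_abs t)"
    using polya_witness_pos exp_abs_bounds(1) by (simp add: less_imp_le abs_mult)
qed

text \<open>As q = exp (-|t|) decreases on the half-line, it suffices that the polynomial 7 q - 5
  q^3 + 2 q^4 increases on (0, 1). Its derivative has the root q = 1, the critical point t = 0,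
  which is factored out.\<close>

lemma polya_witness_antimono: "strict_antimono_on {0..} polya_witness"
proof (rule monotone_onI)
  fix s t :: real
  assume "s \<in> {0..}" "t \<in> {0..}" "s < t"
  then have less: "exp_abs t < exp_abs s"
    by (simp add: exp_abs_def)
  have "(\<lambda>q :: real. 7 * q - 5 * q ^ 3 + 2 * q ^ 4) (exp_abs t) < (\<lambda>q. 7 * q - 5 * q ^ 3 + 2 * q ^ 4) (exp_abs s)"
  proof (rule DERIV_pos_imp_increasing_open[OF less])
    fix q assume "exp_abs t < q" "q < exp_abs s"
    then have q: "0 < q" "q < 1"
      using exp_abs_bounds[of t] exp_abs_bounds[of s] by auto
    have "((\<lambda>q. 7 * q - 5 * q ^ 3 + 2 * q ^ 4) has_real_derivative (1 - q) * (7 + q * (7 - 8 * q))) (at q)"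
      by (rule derivative_eq_intros refl)+ (simp add: eval_nat_numeral algebra_simps)
    \<comment> \<open>From q^2 < q the value exceeds 7 - q.\<close>
    moreover have "0 < 7 + q * (7 - 8 * q)"
    proof -
      have "q * q < q * 1"
        using q by (intro mult_strict_left_mono) auto
      then show ?thesis
        using q right_diff_distrib[of q 7 "8 * q"] by linarith
    qed
    ultimately show "\<exists>y. ((\<lambda>q. 7 * q - 5 * q ^ 3 + 2 * q ^ 4) has_real_derivative y) (at q) \<and> 0 < y"
      using q by (intro exI[of _ "(1 - q) * (7 + q * (7 - 8 * q))"] conjI mult_pos_pos) auto
  qed (intro continuous_intros)
  then show "polya_witness t < polya_witness s"
    by (simp add: polya_witness_def)
qed

lemma polya_witness_mono: "strict_mono_on {..0} polya_witness"
proof (rule monotone_onI)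
  fix s t :: real
  assume "s \<in> {..0}" "t \<in> {..0}" "s < t"
  then have "polya_witness (- s) < polya_witness (- t)"
    by (intro monotone_onD[OF polya_witness_antimono]) auto
  then show "polya_witness s < polya_witness t"
    by (simp add: polya_witness_even)
qed

section \<open>The witness and its powers\<close>

lemma polya_frequency_function_witness: "polya_frequency_function polya_witness"
  unfolding polya_frequency_function_def
proof (intro conjI)
  show "\<exists>s t. s \<noteq> t \<and> polya_witness s \<noteq> 0 \<and> polya_witness t \<noteq> 0"
    using polya_witness_pos[of 0] polya_witness_pos[of 1] by (intro exI[of _ 0] exI[of _ 1]) auto
qed (use polya_witness_pos integrable_polya_witness tn_kernel_polya_witness
      in \<open>auto simp: less_imp_le tn_kernel_def\<close>)

text \<open>Minors of order 4 already fail. The nodes \<open>- ln (u i)\<close> and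
  \<open>ln (v j)\<close> have nonnegative differences, at which \<open>exp_abs\<close> equals
  \<open>u i * v j\<close>; its \<open>n\<close>-th power is a row and column scaling, which leaves
  the \<open>n\<close>-th power of the cubic.\<close>

lemma not_polya_frequency_function_power:
  assumes "2 \<le> n"
  shows "\<not> polya_frequency_function (\<lambda>x. polya_witness x ^ n)"
proof
  assume pf: "polya_frequency_function (\<lambda>x. polya_witness x ^ n)"
  let ?G = "\<lambda>t :: real. (7 - 5 * t\<^sup>2 + 2 * t ^ 3) ^ n"
  have "product_minors_nonneg 1 4 ?G"
    unfolding product_minors_nonneg_def
  proof (intro allI impI)
    fix u v :: "nat \<Rightarrow> real"
    assume uv: "\<forall>i<4. 0 < u i \<and> u i \<le> 1 \<and> 0 < v i \<and> v i \<le> 1"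
      and u: "strict_antimono_on {..<4} u" and v: "strict_mono_on {..<4} v"
    have "strict_mono_on {..<4} (\<lambda>i. - ln (u i))" "strict_mono_on {..<4} (\<lambda>j. ln (v j))"
      using uv u v by (auto simp: monotone_on_def)
    then have "0 \<le> kdet 4 (\<lambda>i j. polya_witness (- ln (u i) - ln (v j)) ^ n)"
      using pf by (simp add: polya_frequency_function_def)
    also have "\<dots> = kdet 4 (\<lambda>i j. u i ^ n * v j ^ n * ?G (u i * v j))"
    proof (rule kdet_cong)
      fix i j :: nat assume "i < 4" "j < 4"
      then have pos: "0 < u i" "0 < v j" and "ln (u i) \<le> 0" "ln (v j) \<le> 0"
        using uv by auto
      then have "\<bar>- ln (u i) - ln (v j)\<bar> = - ln (u i) - ln (v j)"
        by linarith
      then have "exp_abs (- ln (u i) - ln (v j)) = u i * v j"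
        using pos by (simp add: exp_abs_def exp_add)
      then show "polya_witness (- ln (u i) - ln (v j)) ^ n = u i ^ n * v j ^ n * ?G (u i * v j)"
        by (simp add: polya_witness_factor power_mult_distrib)
    qed
    finally have "0 \<le> 1 * kdet 4 (\<lambda>i j. u i ^ n * v j ^ n * ?G (u i * v j))"
      by simp
    then show "0 \<le> 1 * kdet 4 (\<lambda>i j. ?G (u i * v j))"
      by (subst (asm) kdet_scale_sign) (use uv in auto)
  qed
  with cubic_power_not_product_minors_nonneg[OF assms] show False
    by contradiction
qed

theorem lemma8p4:
  shows "\<exists>M :: real \<Rightarrow> real.
    polya_frequency_function M \<and>
    (\<forall>x. M (- x) = M x) \<and> continuous_on UNIV M \<and> (\<forall>x. M x \<noteq> 0) \<and>
    strict_mono_on {..0} M \<and> strict_antimono_on {0..} M \<and>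
    (\<forall>n::nat. n \<ge> 2 \<longrightarrow> \<not> polya_frequency_function (\<lambda>x. M x ^ n))"
proof (intro exI[of _ polya_witness] conjI allI impI)
  show "polya_witness x \<noteq> 0" for x
    using polya_witness_pos[of x] by simp
qed (simp_all add: polya_frequency_function_witness polya_witness_even continuous_on_polya_witness
    polya_witness_mono polya_witness_antimono not_polya_frequency_function_power)

end
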